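(* Let $k\ge 2$. Then, as formal power series in $t$ with coefficients in $\mathbb{Q}(p,q,x)$, $$\sum_{n\ge 0}\frac{t^n}{[n]_{p,q}!}\sum_{(\sigma,w)\in C_k\wr S_n} q^{\mathrm{inv}(\sigma)}p^{\mathrm{coinv}(\sigma)}x^{\mathrm{dmch}(\sigma,w)}=\frac{(k-1)(1-x)}{(k-1)(1-x)+k\sum_{n\ge 1}\frac{p^{\binom{n}{2}}((k-1)(x-1)t)^n}{[n]_{p,q}!}}.$$
   Context: For $k\ge 2$, $n\ge 0$, the wreath product $C_k\wr S_n$ is identified with the set of pairs $(\sigma,w)$ with $\sigma=\sigma_1\cdots\sigma_n\in S_n$ and $w=w_1\cdots w_n\in\{0,1,\dots,k-1\}^n$ (for $n=0$ there is exactly one, empty, element). $\mathrm{inv}(\sigma)=|\{i<j:\sigma_i>\sigma_j\}|$, $\mathrm{coinv}(\sigma)=|\{i<j:\sigma_i<\sigma_j\}|$. Define $\mathrm{dmch}(\sigma,w)=|\{i\in\{1,\dots,n-1\}:\sigma_i<\sigma_{i+1}\text{ and } w_i\neq w_{i+1}\}|$ (the number of bi-matches of the pattern set $\{(1\,2,0\,1),(1\,2,1\,0)\}$). $[n]_{p,q}=\frac{p^n-q^n}{p-q}=p^{n-1}+p^{n-2}q+\cdots+q^{n-1}$ and $[n]_{p,q}!=[n]_{p,q}\cdots[1]_{p,q}$ (with $[0]_{p,q}!=1$). *)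

theory Defs
  imports
    "HOL-Computational_Algebra.Computational_Algebra"
    "HOL-Combinatorics.Permutations"
    "HOL-Library.FuncSet"
begin

text \<open>
  The field \<open>\<rat>(p,q,x)\<close> is the fraction field of \<open>\<rat>[p][q][x]\<close>; the innermost polynomial
  variable is \<open>p\<close>, the middle one \<open>q\<close>, the outermost one \<open>x\<close>.
\<close>

type_synonym ratfun_pqx = "rat poly poly poly fract"

definition p_var :: ratfun_pqx where
  "p_var = to_fract [:[:[:0, 1:]:]:]"

definition q_var :: ratfun_pqx where
  "q_var = to_fract [:[:0, 1:]:]"

definition x_var :: ratfun_pqx where
  "x_var = to_fract [:0, 1:]"

definition pq_num :: "'a \<Rightarrow> 'a \<Rightarrow> nat \<Rightarrow> 'a :: comm_semiring_1" where
  "pq_num p q n = (\<Sum>i<n. p ^ (n - 1 - i) * q ^ i)"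

definition pq_fact :: "'a \<Rightarrow> 'a \<Rightarrow> nat \<Rightarrow> 'a :: comm_semiring_1" where
  "pq_fact p q n = (\<Prod>m=1..n. pq_num p q m)"

lemma pq_num_eq_quotient:
  fixes p q :: "'a :: field"
  assumes "p \<noteq> q"
  shows "pq_num p q n = (p ^ n - q ^ n) / (p - q)"
proof -
  have "p ^ n - q ^ n = (p - q) * pq_num p q n"
  proof (cases n)
    case (Suc m)
    have "p ^ Suc m - q ^ Suc m = (p - q) * (\<Sum>i<Suc m. p ^ i * q ^ (m - i))"
      by (rule diff_power_eq_sum)
    also have "(\<Sum>i<Suc m. p ^ i * q ^ (m - i)) = (\<Sum>i<Suc m. p ^ (m - i) * q ^ i)"
      by (rule sum.reindex_bij_witness[of _ "\<lambda>i. m - i" "\<lambda>i. m - i"]) auto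
    finally show ?thesis by (simp add: Suc pq_num_def)
  qed (simp add: pq_num_def)
  with assms show ?thesis by simp
qed

text \<open>
  The underlying set of \<open>C\<^sub>k \<wr> S\<^sub>n\<close>.  Words over \<open>{0,\<dots>,k-1}\<close> are extensional functions on
  \<open>{1..n}\<close>, so that each word is counted once.
\<close>

definition wreath :: "nat \<Rightarrow> nat \<Rightarrow> ((nat \<Rightarrow> nat) \<times> (nat \<Rightarrow> nat)) set" where
  "wreath k n = {\<sigma>. \<sigma> permutes {1..n}} \<times> ({1..n} \<rightarrow>\<^sub>E {0..<k})"

definition inv_stat :: "nat \<Rightarrow> (nat \<Rightarrow> nat) \<Rightarrow> nat" where
  "inv_stat n \<sigma> = card {(i, j). i \<in> {1..n} \<and> j \<in> {1..n} \<and> i < j \<and> \<sigma> i > \<sigma> j}"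

definition coinv_stat :: "nat \<Rightarrow> (nat \<Rightarrow> nat) \<Rightarrow> nat" where
  "coinv_stat n \<sigma> = card {(i, j). i \<in> {1..n} \<and> j \<in> {1..n} \<and> i < j \<and> \<sigma> i < \<sigma> j}"

definition dmch :: "nat \<Rightarrow> (nat \<Rightarrow> nat) \<Rightarrow> (nat \<Rightarrow> nat) \<Rightarrow> nat" where
  "dmch n \<sigma> w = card {i \<in> {1..<n}. \<sigma> i < \<sigma> (i + 1) \<and> w i \<noteq> w (i + 1)}"

end

theory Submission
  imports Defs
begin

text \<open>
  Summing over the words first, every ascent of \<open>\<sigma>\<close> contributes the factor \<open>1 + (k - 1) x\<close> and
  every other position the factor \<open>k\<close>, so the numerators \<open>A\<^sub>n\<close> become weighted Eulerian sums over
  permutations.  Removing the last entry \<open>v\<close> of a permutation of \<open>{1..n+1}\<close> and standardising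
  changes \<open>inv\<close> by \<open>n + 1 - v\<close> and \<open>coinv\<close> by \<open>v - 1\<close>, and creates an ascent iff the new last entry
  is less than \<open>v\<close>.  Iterating this recursion for the sum over all permutations with last entry at
  most \<open>v\<close> gives a closed form in which the coefficients are \<open>p,q\<close>-binomial coefficients; at \<open>v = n\<close>
  it reads \<open>A\<^sub>n = \<Sum>\<^sub>m k d\<^bsup>m-1\<^esup> p\<^bsup>m choose 2\<^esup> [n choose m] A\<^bsub>n-m\<^esub>\<close> with \<open>d = (k - 1) (x - 1)\<close>, which is
  the asserted identity multiplied by its denominator.
\<close>

section \<open>The \<open>p,q\<close>-binomial coefficients\<close>

text \<open>A Pascal rule avoids division, so the coefficients exist in every commutative semiring.
  Where \<open>n - m\<close> is truncated, it multiplies 0.\<close>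

fun pq_binom :: "'a \<Rightarrow> 'a \<Rightarrow> nat \<Rightarrow> nat \<Rightarrow> 'a :: comm_semiring_1" where
  "pq_binom p q n 0 = 1"
| "pq_binom p q 0 (Suc m) = 0"
| "pq_binom p q (Suc n) (Suc m) = q ^ Suc m * pq_binom p q n (Suc m) + p ^ (n - m) * pq_binom p q n m"

lemma pq_binom_eq_0: "n < m \<Longrightarrow> pq_binom p q n m = 0"
  by (induction p q n m rule: pq_binom.induct) auto

lemma pq_fact_0 [simp]: "pq_fact p q 0 = 1"
  by (simp add: pq_fact_def)

lemma pq_fact_Suc: "pq_fact p q (Suc n) = pq_fact p q n * pq_num p q (Suc n)"
  by (simp add: pq_fact_def)

lemma pq_num_Suc: "pq_num p q (Suc n) = p * pq_num p q n + q ^ n"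
proof -
  have "(\<Sum>i<n. p ^ (n - i) * q ^ i) = (\<Sum>i<n. p * (p ^ (n - 1 - i) * q ^ i))"
  proof (intro sum.cong refl)
    fix i assume "i \<in> {..<n}"
    then have "n - i = Suc (n - 1 - i)" by auto
    then show "p ^ (n - i) * q ^ i = p * (p ^ (n - 1 - i) * q ^ i)" by (simp add: mult.assoc)
  qed
  then show ?thesis by (simp add: pq_num_def sum_distrib_left)
qed

lemma pq_num_add: "pq_num p q (m + n) = p ^ n * pq_num p q m + q ^ m * pq_num p q n"
proof (induction n)
  case (Suc n)
  then show ?case by (simp add: pq_num_Suc power_add algebra_simps)
qed (simp add: pq_num_def)

text \<open>The Pascal rule is compatible with factorials because [n+1] splits as p^(n-m) [m+1] +
  q^(m+1) [n-m].\<close>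

lemma pq_binom_fact:
  "m \<le> n \<Longrightarrow> pq_binom p q n m * (pq_fact p q m * pq_fact p q (n - m)) = pq_fact p q n"
proof (induction p q n m rule: pq_binom.induct)
  case (3 p q n m)
  show ?case
  proof (cases "m = n")
    case True
    with 3 show ?thesis
      by (simp add: pq_binom_eq_0 pq_fact_Suc flip: mult.assoc)
  next
    case False
    with 3 have "m < n" by simp
    then obtain r where n: "n = m + Suc r" by (metis add_Suc_right less_imp_Suc_add)
    then have r: "n - m = Suc r" "n - Suc m = r" by simp_all
    have IH1: "pq_binom p q n (Suc m) * (pq_fact p q (Suc m) * pq_fact p q r) = pq_fact p q n"
      and IH2: "pq_binom p q n m * (pq_fact p q m * pq_fact p q (Suc r)) = pq_fact p q n"
      using 3 \<open>m < n\<close> r by auto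
    have num: "pq_num p q (Suc n) = p ^ Suc r * pq_num p q (Suc m) + q ^ Suc m * pq_num p q (Suc r)"
      using pq_num_add[of p q "Suc m" "Suc r"] n by simp
    have "pq_binom p q (Suc n) (Suc m) * (pq_fact p q (Suc m) * pq_fact p q (Suc r))
        = q ^ Suc m * pq_num p q (Suc r) *
            (pq_binom p q n (Suc m) * (pq_fact p q (Suc m) * pq_fact p q r))
          + p ^ Suc r * pq_num p q (Suc m) *
            (pq_binom p q n m * (pq_fact p q m * pq_fact p q (Suc r)))"
      by (simp add: r(1) pq_fact_Suc algebra_simps)
    also have "\<dots> = pq_fact p q (Suc n)"
      unfolding IH1 IH2 by (simp add: pq_fact_Suc num algebra_simps)
    finally show ?thesis by (simp add: r)
  qed
qed auto

section \<open>Removing the last entry of a permutation\<close>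

text \<open>Sends \<open>Suc n\<close> to \<open>v\<close> and \<open>{1..n}\<close> increasingly
  onto the other values, so composing it after \<open>\<sigma>\<close> appends \<open>v\<close> and
  undoes the standardisation.\<close>

definition insert_last :: "nat \<Rightarrow> nat \<Rightarrow> nat \<Rightarrow> nat" where
  "insert_last n v u = (if u = Suc n then v else if v \<le> u \<and> u \<le> n then Suc u else u)"

lemma insert_last_permutes:
  assumes "v \<in> {1..Suc n}"
  shows "insert_last n v permutes {1..Suc n}"
proof (rule bij_imp_permutes)
  have "inj_on (insert_last n v) {1..Suc n}"
    by (auto simp: inj_on_def insert_last_def split: if_splits)
  moreover have "insert_last n v ` {1..Suc n} \<subseteq> {1..Suc n}"
    using assms by (auto simp: insert_last_def)
  ultimately show "bij_betw (insert_last n v) {1..Suc n} {1..Suc n}"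
    by (simp add: bij_betw_def endo_inj_surj)
qed (use assms in \<open>auto simp: insert_last_def\<close>)

text \<open>A permutation of \<open>{1..n}\<close> fixes \<open>Suc n\<close>, so the composite
  takes the value \<open>v\<close> there; conversely, composing with the inverse makes
  \<open>Suc n\<close> a fixed point again.\<close>

lemma bij_betw_insert_last:
  assumes v: "v \<in> {1..Suc n}"
  shows "bij_betw (\<lambda>\<sigma>. insert_last n v \<circ> \<sigma>)
           {\<sigma>. \<sigma> permutes {1..n}} {\<sigma>. \<sigma> permutes {1..Suc n} \<and> \<sigma> (Suc n) = v}"
proof (rule bij_betw_byWitness[where f' = "\<lambda>\<sigma>. inv (insert_last n v) \<circ> \<sigma>"])
  let ?t = "insert_last n v"
  note t = insert_last_permutes[OF v]
  have bij: "bij ?t" using t by (rule permutes_bij)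
  have last: "?t (Suc n) = v" by (simp add: insert_last_def)
  then have inv_last: "inv ?t v = Suc n" by (rule inv_f_eq[OF bij_is_inj[OF bij]])
  show "\<forall>\<sigma>\<in>{\<sigma>. \<sigma> permutes {1..n}}. inv ?t \<circ> (?t \<circ> \<sigma>) = \<sigma>"
    using bij by (auto simp: fun_eq_iff bij_is_inj)
  show "\<forall>\<sigma>\<in>{\<sigma>. \<sigma> permutes {1..Suc n} \<and> \<sigma> (Suc n) = v}. ?t \<circ> (inv ?t \<circ> \<sigma>) = \<sigma>"
    using bij by (auto simp: fun_eq_iff bij_is_surj surj_f_inv_f)
  show "(\<lambda>\<sigma>. ?t \<circ> \<sigma>) ` {\<sigma>. \<sigma> permutes {1..n}} \<subseteq> {\<sigma>. \<sigma> permutes {1..Suc n} \<and> \<sigma> (Suc n) = v}"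
  proof safe
    fix \<sigma> assume s: "\<sigma> permutes {1..n}"
    then have "\<sigma> permutes {1..Suc n}" by (rule permutes_subset) auto
    then show "?t \<circ> \<sigma> permutes {1..Suc n}" using t by (rule permutes_compose)
    show "(?t \<circ> \<sigma>) (Suc n) = v" using permutes_not_in[OF s, of "Suc n"] last by simp
  qed
  show "(\<lambda>\<sigma>. inv ?t \<circ> \<sigma>) ` {\<sigma>. \<sigma> permutes {1..Suc n} \<and> \<sigma> (Suc n) = v} \<subseteq> {\<sigma>. \<sigma> permutes {1..n}}"
  proof (rule image_subsetI)
    fix \<sigma> assume "\<sigma> \<in> {\<sigma>. \<sigma> permutes {1..Suc n} \<and> \<sigma> (Suc n) = v}"
    then have s: "\<sigma> permutes {1..Suc n}" "\<sigma> (Suc n) = v" by simp_all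
    have "inv ?t \<circ> \<sigma> permutes {1..Suc n}"
      using s(1) permutes_inv[OF t] by (rule permutes_compose)
    then have "inv ?t \<circ> \<sigma> permutes {1..n}"
    proof (rule permutes_superset)
      fix u assume "u \<in> {1..Suc n} - {1..n}"
      then have "u = Suc n" by auto
      then show "(inv ?t \<circ> \<sigma>) u = u"
        using inv_last by (simp add: s(2))
    qed
    then show "inv ?t \<circ> \<sigma> \<in> {\<sigma>. \<sigma> permutes {1..n}}" by simp
  qed
qed

text \<open>Turns a count over positions into one over values, where new inversions are easy to
  count.\<close>

lemma card_permutes_image_Collect:
  assumes "\<sigma> permutes {1..n}"
  shows "card {i \<in> {1..n}. P (\<sigma> i)} = card {u \<in> {1..n}. P u}"
proof -
  have "\<sigma> ` {i \<in> {1..n}. P (\<sigma> i)} = {u \<in> \<sigma> ` {1..n}. P u}" by auto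
  also have "\<dots> = {u \<in> {1..n}. P u}" by (simp only: permutes_image[OF assms])
  finally have "\<sigma> ` {i \<in> {1..n}. P (\<sigma> i)} = {u \<in> {1..n}. P u}" .
  moreover have "inj_on \<sigma> {i \<in> {1..n}. P (\<sigma> i)}"
    using permutes_inj_on[OF assms] .
  ultimately show ?thesis by (metis card_image)
qed

lemma insert_last_less_iff:
  assumes "u \<le> n" "u' \<le> n"
  shows "insert_last n v u < insert_last n v u' \<longleftrightarrow> u < u'"
  using assms by (auto simp: insert_last_def)

lemma card_pairs_Suc:
  "card {(i, j). i \<in> {1..Suc n} \<and> j \<in> {1..Suc n} \<and> i < j \<and> P i j}
   = card {(i, j). i \<in> {1..n} \<and> j \<in> {1..n} \<and> i < j \<and> P i j} + card {i \<in> {1..n}. P i (Suc n)}"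
proof -
  let ?A = "{(i, j). i \<in> {1..n} \<and> j \<in> {1..n} \<and> i < j \<and> P i j}"
  let ?B = "{i \<in> {1..n}. P i (Suc n)}"
  have "{(i, j). i \<in> {1..Suc n} \<and> j \<in> {1..Suc n} \<and> i < j \<and> P i j} = ?A \<union> (\<lambda>i. (i, Suc n)) ` ?B"
    by (auto simp: le_Suc_eq)
  moreover have "finite ?A"
    by (rule finite_subset[of _ "{1..n} \<times> {1..n}"]) auto
  moreover have "?A \<inter> (\<lambda>i. (i, Suc n)) ` ?B = {}" by auto
  ultimately show ?thesis
    by (simp add: card_Un_disjoint card_image inj_on_def)
qed

text \<open>Old pairs keep their order, as \<open>insert_last\<close> is increasing on old values.
  New inversions come from the old values \<open>u \<ge> v\<close>, which move up past
  \<open>v\<close>.\<close>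

lemma inv_stat_insert_last:
  assumes s: "\<sigma> permutes {1..n}" and v: "v \<in> {1..Suc n}"
  shows "inv_stat (Suc n) (insert_last n v \<circ> \<sigma>) = inv_stat n \<sigma> + (Suc n - v)"
proof -
  have in_range: "\<sigma> i \<le> n" if "i \<in> {1..n}" for i
    using permutes_in_image[OF s, of i] that by auto
  have last: "\<sigma> (Suc n) = Suc n" using permutes_not_in[OF s, of "Suc n"] by simp
  have "card {i \<in> {1..n}. v < insert_last n v (\<sigma> i)} = card {u \<in> {1..n}. v < insert_last n v u}"
    by (rule card_permutes_image_Collect[OF s])
  also have "{u \<in> {1..n}. v < insert_last n v u} = {v..n}"
    using v by (auto simp: insert_last_def)
  finally have "card {i \<in> {1..n}. v < insert_last n v (\<sigma> i)} = Suc n - v" by simp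
  moreover have "{(i, j). i \<in> {1..n} \<and> j \<in> {1..n} \<and> i < j \<and> insert_last n v (\<sigma> j) < insert_last n v (\<sigma> i)}
      = {(i, j). i \<in> {1..n} \<and> j \<in> {1..n} \<and> i < j \<and> \<sigma> j < \<sigma> i}"
    using in_range by (auto simp: insert_last_less_iff)
  ultimately show ?thesis
    unfolding inv_stat_def o_def card_pairs_Suc last by (simp add: insert_last_def)
qed

lemma coinv_stat_insert_last:
  assumes s: "\<sigma> permutes {1..n}" and v: "v \<in> {1..Suc n}"
  shows "coinv_stat (Suc n) (insert_last n v \<circ> \<sigma>) = coinv_stat n \<sigma> + (v - 1)"
proof -
  have in_range: "\<sigma> i \<le> n" if "i \<in> {1..n}" for i
    using permutes_in_image[OF s, of i] that by auto
  have last: "\<sigma> (Suc n) = Suc n" using permutes_not_in[OF s, of "Suc n"] by simp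
  have "card {i \<in> {1..n}. insert_last n v (\<sigma> i) < v} = card {u \<in> {1..n}. insert_last n v u < v}"
    by (rule card_permutes_image_Collect[OF s])
  also have "{u \<in> {1..n}. insert_last n v u < v} = {1..<v}"
    using v by (auto simp: insert_last_def)
  finally have "card {i \<in> {1..n}. insert_last n v (\<sigma> i) < v} = v - 1" by simp
  moreover have "{(i, j). i \<in> {1..n} \<and> j \<in> {1..n} \<and> i < j \<and> insert_last n v (\<sigma> i) < insert_last n v (\<sigma> j)}
      = {(i, j). i \<in> {1..n} \<and> j \<in> {1..n} \<and> i < j \<and> \<sigma> i < \<sigma> j}"
    using in_range by (auto simp: insert_last_less_iff)
  ultimately show ?thesis
    unfolding coinv_stat_def o_def card_pairs_Suc last by (simp add: insert_last_def)
qed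

section \<open>Weighted Eulerian sums\<close>

text \<open>
  Index \<open>0\<close> is never an ascent, although \<open>\<sigma> 0 = 0 < \<sigma> 1\<close>: it carries the factor \<open>b\<close> of the first letter.
\<close>

definition asc_prod :: "'a \<Rightarrow> 'a \<Rightarrow> nat \<Rightarrow> (nat \<Rightarrow> nat) \<Rightarrow> 'a :: comm_ring_1" where
  "asc_prod a b n \<sigma> = (\<Prod>i<n. if i \<noteq> 0 \<and> \<sigma> i < \<sigma> (Suc i) then a else b)"

definition perm_weight :: "'a \<Rightarrow> 'a \<Rightarrow> 'a \<Rightarrow> 'a \<Rightarrow> nat \<Rightarrow> (nat \<Rightarrow> nat) \<Rightarrow> 'a :: comm_ring_1" where
  "perm_weight p q a b n \<sigma> = q ^ inv_stat n \<sigma> * p ^ coinv_stat n \<sigma> * asc_prod a b n \<sigma>"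

definition eul_sum :: "'a \<Rightarrow> 'a \<Rightarrow> 'a \<Rightarrow> 'a \<Rightarrow> nat \<Rightarrow> 'a :: comm_ring_1" where
  "eul_sum p q a b n = (\<Sum>\<sigma> | \<sigma> permutes {1..n}. perm_weight p q a b n \<sigma>)"

text \<open>The lower bound 1 makes the sum empty for \<open>n = 0\<close>, where
  \<open>\<sigma> 0 = 0\<close>, so a first entry never counts as an ascent in the
  recursion.\<close>

definition eul_sum_le :: "'a \<Rightarrow> 'a \<Rightarrow> 'a \<Rightarrow> 'a \<Rightarrow> nat \<Rightarrow> nat \<Rightarrow> 'a :: comm_ring_1" where
  "eul_sum_le p q a b n v
     = (\<Sum>\<sigma> | \<sigma> permutes {1..n} \<and> \<sigma> n \<in> {1..v}. perm_weight p q a b n \<sigma>)"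

text \<open>Old last entries up to \<open>v\<close> stay below the inserted \<open>Suc v\<close>,
  and larger ones are lifted above it. The new entry has \<open>v\<close> smaller and
  \<open>n - v\<close> larger predecessors.\<close>

lemma perm_weight_insert_last:
  assumes s: "\<sigma> permutes {1..n}" and v: "v \<le> n"
  shows "perm_weight p q a b (Suc n) (insert_last n (Suc v) \<circ> \<sigma>)
    = p ^ v * q ^ (n - v) *
      ((if \<sigma> n \<in> {1..v} then a else b) * perm_weight p q a b n \<sigma>)"
proof -
  have in_range: "\<sigma> i \<in> {1..n}" if "i \<in> {1..n}" for i
    using permutes_in_image[OF s, of i] that by auto
  have last: "\<sigma> (Suc n) = Suc n" using permutes_not_in[OF s, of "Suc n"] by simp
  have "asc_prod a b n (insert_last n (Suc v) \<circ> \<sigma>) = asc_prod a b n \<sigma>"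
    unfolding asc_prod_def
  proof (intro prod.cong refl)
    fix i assume "i \<in> {..<n}"
    then have "i \<noteq> 0 \<Longrightarrow> \<sigma> i \<le> n \<and> \<sigma> (Suc i) \<le> n"
      using in_range[of i] in_range[of "Suc i"] by auto
    then show "(if i \<noteq> 0 \<and> (insert_last n (Suc v) \<circ> \<sigma>) i < (insert_last n (Suc v) \<circ> \<sigma>) (Suc i) then a else b)
      = (if i \<noteq> 0 \<and> \<sigma> i < \<sigma> (Suc i) then a else b)"
      by (auto simp: insert_last_less_iff)
  qed
  moreover have "(n \<noteq> 0 \<and> (insert_last n (Suc v) \<circ> \<sigma>) n < (insert_last n (Suc v) \<circ> \<sigma>) (Suc n))
      \<longleftrightarrow> \<sigma> n \<in> {1..v}"
  proof (cases "n = 0")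
    case True
    then show ?thesis using v by simp
  next
    case False
    then show ?thesis using in_range[of n] last by (auto simp: insert_last_def)
  qed
  ultimately have "asc_prod a b (Suc n) (insert_last n (Suc v) \<circ> \<sigma>)
      = asc_prod a b n \<sigma> * (if \<sigma> n \<in> {1..v} then a else b)"
    unfolding asc_prod_def prod.lessThan_Suc by presburger
  moreover have "inv_stat (Suc n) (insert_last n (Suc v) \<circ> \<sigma>) = inv_stat n \<sigma> + (n - v)"
    using inv_stat_insert_last[OF s, of "Suc v"] v by simp
  moreover have "coinv_stat (Suc n) (insert_last n (Suc v) \<circ> \<sigma>) = coinv_stat n \<sigma> + v"
    using coinv_stat_insert_last[OF s, of "Suc v"] v by simp
  ultimately show ?thesis
    by (simp only: perm_weight_def power_add mult_ac)
qed

lemma eul_sum_le_0 [simp]: "eul_sum_le p q a b n 0 = 0"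
  by (simp add: eul_sum_le_def)

lemma eul_sum_0 [simp]: "eul_sum p q a b 0 = 1"
  by (simp add: eul_sum_def perm_weight_def asc_prod_def inv_stat_def coinv_stat_def)

lemma eul_sum_eq_eul_sum_le:
  assumes "n > 0"
  shows "eul_sum p q a b n = eul_sum_le p q a b n n"
proof -
  have "\<sigma> n \<in> {1..n}" if "\<sigma> permutes {1..n}" for \<sigma>
    using permutes_in_image[OF that, of n] assms by simp
  then have "{\<sigma>. \<sigma> permutes {1..n}} = {\<sigma>. \<sigma> permutes {1..n} \<and> \<sigma> n \<in> {1..n}}" by blast
  then show ?thesis by (simp only: eul_sum_def eul_sum_le_def)
qed

lemma eul_sum_le_Suc:
  assumes v: "v \<le> n"
  shows "eul_sum_le p q a b (Suc n) (Suc v) = eul_sum_le p q a b (Suc n) v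
    + p ^ v * q ^ (n - v) * (b * eul_sum p q a b n + (a - b) * eul_sum_le p q a b n v)"
proof -
  let ?W = "perm_weight p q a b"
  let ?S = "{\<sigma>. \<sigma> permutes {1..n}}"
  have fin: "finite {\<sigma>. \<sigma> permutes {1..m}}" for m :: nat
    by (simp add: finite_permutations)
  have "{\<sigma>. \<sigma> permutes {1..Suc n} \<and> \<sigma> (Suc n) \<in> {1..Suc v}}
      = {\<sigma>. \<sigma> permutes {1..Suc n} \<and> \<sigma> (Suc n) \<in> {1..v}}
        \<union> {\<sigma>. \<sigma> permutes {1..Suc n} \<and> \<sigma> (Suc n) = Suc v}"
    by auto
  moreover have "finite {\<sigma>. \<sigma> permutes {1..Suc n} \<and> P \<sigma>}" for P
    by (rule finite_subset[OF _ fin[of "Suc n"]]) auto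
  ultimately have "eul_sum_le p q a b (Suc n) (Suc v) = eul_sum_le p q a b (Suc n) v
      + (\<Sum>\<sigma> | \<sigma> permutes {1..Suc n} \<and> \<sigma> (Suc n) = Suc v. ?W (Suc n) \<sigma>)"
    unfolding eul_sum_le_def by (simp only:) (subst sum.union_disjoint, auto)
  also have "(\<Sum>\<sigma> | \<sigma> permutes {1..Suc n} \<and> \<sigma> (Suc n) = Suc v. ?W (Suc n) \<sigma>)
      = (\<Sum>\<sigma>\<in>?S. ?W (Suc n) (insert_last n (Suc v) \<circ> \<sigma>))"
    using v by (intro sum.reindex_bij_betw[symmetric] bij_betw_insert_last) auto
  \<comment> \<open>The factor \<open>a\<close> or \<open>b\<close> is split as \<open>b\<close>
    plus \<open>a - b\<close> on ascents, which makes the unrestricted sum appear.\<close>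
  also have "\<dots> = (\<Sum>\<sigma>\<in>?S. p ^ v * q ^ (n - v) *
      (b * ?W n \<sigma> + (a - b) * (if \<sigma> n \<in> {1..v} then ?W n \<sigma> else 0)))"
    using v by (intro sum.cong) (auto simp: perm_weight_insert_last algebra_simps)
  also have "\<dots> = p ^ v * q ^ (n - v) *
      (b * eul_sum p q a b n + (a - b) * (\<Sum>\<sigma>\<in>?S. if \<sigma> n \<in> {1..v} then ?W n \<sigma> else 0))"
    by (simp only: eul_sum_def sum_distrib_left sum.distrib distrib_left)
  also have "(\<Sum>\<sigma>\<in>?S. if \<sigma> n \<in> {1..v} then ?W n \<sigma> else 0) = eul_sum_le p q a b n v"
    unfolding eul_sum_le_def sum.inter_filter[OF fin, symmetric] by simp
  finally show ?thesis .
qed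

section \<open>Closed form for sums with bounded last entry\<close>

text \<open>
  \<open>gauss p q n m v\<close> is the sum of \<open>\<Prod>\<^sub>j p\<^bsup>c j - 1\<^esup> q\<^bsup>j - c j\<^esup>\<close> over all sequences
  \<open>1 \<le> c (n-m+1) < \<dots> < c n \<le> v\<close>, evaluated by Gauss's formula.
\<close>

definition gauss :: "'a \<Rightarrow> 'a \<Rightarrow> nat \<Rightarrow> nat \<Rightarrow> nat \<Rightarrow> 'a :: comm_semiring_1" where
  "gauss p q n m v = q ^ (m * (n - v)) * p ^ (m choose 2) * pq_binom p q v m"

text \<open>Either the largest entry of the sequence is at most \<open>v\<close>, or it is
  \<open>Suc v\<close> with weight \<open>p ^ v * q ^ (n - v)\<close>. In closed form this is the
  Pascal rule.\<close>

lemma gauss_Suc: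
  assumes "v \<le> n"
  shows "gauss p q (Suc n) (Suc m) (Suc v)
    = gauss p q (Suc n) (Suc m) v + p ^ v * q ^ (n - v) * gauss p q n m v"
proof (cases "m \<le> v")
  case True
  then have p: "p ^ v = p ^ (v - m) * p ^ m" by (simp flip: power_add)
  have c: "Suc m choose 2 = m + (m choose 2)" by (simp add: numeral_2_eq_2)
  obtain l where n: "n = v + l" using assms le_Suc_ex by blast
  show ?thesis
    by (simp add: n gauss_def c p power_add algebra_simps)
\<comment> \<open>Here \<open>v - m\<close> is truncated, but all three coefficients vanish.\<close>
next
  case False
  then show ?thesis by (simp add: gauss_def pq_binom_eq_0)
qed

text \<open>Unrolling \<open>eul_sum_le_Suc\<close>, each step stops with factor \<open>b\<close>
  and a full sum or continues with \<open>a - b\<close>. The index \<open>m\<close> counts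
  continuations, and \<open>gauss\<close> collects the weights of the removed last entries.\<close>

lemma eul_sum_le_closed_form:
  assumes "v \<le> n"
  shows "eul_sum_le p q a b n v
    = (\<Sum>m<n. b * (a - b) ^ m * eul_sum p q a b (n - Suc m) * gauss p q n (Suc m) v)"
  using assms
proof (induction n arbitrary: v)
  case (Suc n)
  note IH = Suc.IH
  let ?d = "a - b" and ?E = "eul_sum p q a b"
  from Suc.prems show ?case
  proof (induction v)
    case (Suc v)
    then have v: "v \<le> n" by simp
    \<comment> \<open>Since \<open>gauss p q n 0 v = 1\<close>, the term \<open>m = 0\<close> is the
      stopped part; the rest is \<open>a - b\<close> times the outer induction hypothesis.\<close>
    have "(\<Sum>m<Suc n. b * ?d ^ m * ?E (n - m) * gauss p q n m v)
        = b * ?E n + (\<Sum>m<n. b * ?d ^ Suc m * ?E (n - Suc m) * gauss p q n (Suc m) v)"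
      by (subst sum.lessThan_Suc_shift) (simp add: gauss_def numeral_2_eq_2)
    also have "\<dots> = b * ?E n + ?d * eul_sum_le p q a b n v"
      by (simp add: IH[OF v] sum_distrib_left mult_ac)
    finally have "eul_sum_le p q a b (Suc n) (Suc v)
        = (\<Sum>m<Suc n. b * ?d ^ m * ?E (n - m) * gauss p q (Suc n) (Suc m) v)
          + p ^ v * q ^ (n - v) * (\<Sum>m<Suc n. b * ?d ^ m * ?E (n - m) * gauss p q n m v)"
      using Suc.IH v by (simp only: eul_sum_le_Suc[OF v]) simp
    then show ?case
      by (simp only: gauss_Suc[OF v] distrib_left sum.distrib sum_distrib_left diff_Suc_Suc mult_ac)
  qed (simp add: gauss_def)
qed (simp add: eul_sum_le_def)

text \<open>At \<open>v = n\<close> the power of \<open>q\<close> in \<open>gauss\<close>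
  disappears.\<close>

lemma eul_sum_recurrence:
  assumes "n > 0"
  shows "eul_sum p q a b n
    = (\<Sum>m<n. b * (a - b) ^ m * eul_sum p q a b (n - Suc m) *
        (p ^ (Suc m choose 2) * pq_binom p q n (Suc m)))"
  using eul_sum_le_closed_form[of n n p q a b] eul_sum_eq_eul_sum_le[OF assms, of p q a b]
  by (simp add: gauss_def)

section \<open>From the recurrence to the generating function\<close>

lemma fps_eul_sum:
  fixes p q a b :: "'a :: field"
  assumes nz: "\<And>n. pq_fact p q n \<noteq> 0" and ab: "a \<noteq> b"
  shows "Abs_fps (\<lambda>n. eul_sum p q a b n / pq_fact p q n)
    = fps_const (b - a) / (fps_const (b - a) + fps_const b *
        Abs_fps (\<lambda>n. if n = 0 then 0 else p ^ (n choose 2) * (a - b) ^ n / pq_fact p q n))"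
    (is "?F = ?N / (?N + fps_const b * ?G)")
proof -
  let ?E = "eul_sum p q a b" and ?f = "pq_fact p q"
  \<comment> \<open>This is the recurrence divided by \<open>pq_fact p q n\<close>.\<close>
  have conv: "(?G * ?F) $ n * b = (a - b) * ?F $ n" if "n > 0" for n
  proof -
    have "(?G * ?F) $ n * b = (\<Sum>i\<in>{Suc 0..<Suc n}. ?G $ i * ?F $ (n - i) * b)"
      by (simp add: fps_mult_nth sum_distrib_right atLeast0AtMost[symmetric]
          sum.atLeast_Suc_atMost atLeastLessThanSuc_atLeastAtMost)
    also have "\<dots> = (\<Sum>m<n. ?G $ Suc m * ?F $ (n - Suc m) * b)"
      by (simp only: sum.shift_bounds_Suc_ivl atLeast0LessThan)
    also have "\<dots> = (\<Sum>m<n. (a - b) * (b * (a - b) ^ m * ?E (n - Suc m) *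
        (p ^ (Suc m choose 2) * pq_binom p q n (Suc m))) / ?f n)"
    proof (intro sum.cong refl)
      fix m assume "m \<in> {..<n}"
      then have "pq_binom p q n (Suc m) * (?f (Suc m) * ?f (n - Suc m)) = ?f n"
        by (intro pq_binom_fact) auto
      then have "pq_binom p q n (Suc m) / ?f n = 1 / (?f (Suc m) * ?f (n - Suc m))"
        using nz[of n] nz[of "Suc m"] nz[of "n - Suc m"] by (simp add: field_simps)
      then have "(a - b) ^ Suc m * b * ?E (n - Suc m) * p ^ (Suc m choose 2)
            * (pq_binom p q n (Suc m) / ?f n)
          = (a - b) ^ Suc m * b * ?E (n - Suc m) * p ^ (Suc m choose 2)
            * (1 / (?f (Suc m) * ?f (n - Suc m)))"
        by simp
      then show "?G $ Suc m * ?F $ (n - Suc m) * b = (a - b) * (b * (a - b) ^ m * ?E (n - Suc m) *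
          (p ^ (Suc m choose 2) * pq_binom p q n (Suc m))) / ?f n"
        by (simp add: mult_ac)
    qed
    also have "\<dots> = (a - b) * ?E n / ?f n"
      by (simp only: eul_sum_recurrence[OF that] sum_distrib_left sum_divide_distrib)
    finally show ?thesis by simp
  qed
  \<comment> \<open>With constant coefficients 1 of \<open>?F\<close> and 0 of \<open>?G\<close>,
    \<open>conv\<close> amounts to b G F = (a - b) (F - 1).\<close>
  have "?F * (?N + fps_const b * ?G) = ?N"
  proof (rule fps_ext)
    fix n
    have *: "(?F * (?N + fps_const b * ?G)) $ n = (b - a) * ?F $ n + (?G * ?F) $ n * b"
      by (simp only: mult.commute[of ?F] distrib_right mult.assoc fps_add_nth
          fps_mult_left_const_nth mult.commute[of b])
    show "(?F * (?N + fps_const b * ?G)) $ n = ?N $ n"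
    proof (cases "n = 0")
      case False
      then have "(?F * (?N + fps_const b * ?G)) $ n = (b - a) * ?F $ n + (a - b) * ?F $ n"
        using * conv by simp
      also have "\<dots> = ((b - a) + (a - b)) * ?F $ n" by (simp only: distrib_right)
      finally show ?thesis using False by simp
    qed simp
  qed
  moreover have "(?N + fps_const b * ?G) $ 0 \<noteq> 0" using ab by simp
  then have "?N + fps_const b * ?G \<noteq> 0" by (rule contrapos_nn) simp
  then have "?F * (?N + fps_const b * ?G) / (?N + fps_const b * ?G) = ?F"
    by (rule nonzero_mult_div_cancel_right)
  ultimately show ?thesis by simp
qed

section \<open>Summing over the words\<close>

text \<open>At an ascent the new letter repeats its predecessor in one way and differs from it in k
  - 1 ways, giving 1 + (k - 1) x, written here so that its difference from k is visible.\<close>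

lemma sum_dmch_words:
  fixes x :: "'a :: comm_ring_1"
  assumes "k > 0"
  shows "(\<Sum>w\<in>{1..n} \<rightarrow>\<^sub>E {0..<k}. x ^ dmch n \<sigma> w)
    = asc_prod (of_nat k + (of_nat k - 1) * (x - 1)) (of_nat k) n \<sigma>"
proof (induction n)
  case 0
  then show ?case by (simp add: dmch_def asc_prod_def)
next
  case (Suc n)
  let ?W = "{1..n} \<rightarrow>\<^sub>E {0..<k}"
  let ?h = "\<lambda>a b. if n \<noteq> 0 \<and> \<sigma> n < \<sigma> (Suc n) \<and> b \<noteq> a then x else 1"
  have dmch: "x ^ dmch (Suc n) \<sigma> (w(Suc n := c)) = x ^ dmch n \<sigma> w * ?h c (w n)" for w c
  proof -
    let ?A = "{i \<in> {1..<n}. \<sigma> i < \<sigma> (i + 1) \<and> w i \<noteq> w (i + 1)}"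
    have "{i \<in> {1..<Suc n}. \<sigma> i < \<sigma> (i + 1) \<and> (w(Suc n := c)) i \<noteq> (w(Suc n := c)) (i + 1)}
        = (if n \<noteq> 0 \<and> \<sigma> n < \<sigma> (Suc n) \<and> w n \<noteq> c then insert n ?A else ?A)"
      by (auto simp: less_Suc_eq)
    then show ?thesis by (simp add: dmch_def)
  qed
  \<comment> \<open>The premise is guarded because for \<open>n = 0\<close> the value
    \<open>w 0\<close> lies outside the word and need not be below \<open>k\<close>.\<close>
  have inner: "(\<Sum>c<k. ?h c b) = (if n \<noteq> 0 \<and> \<sigma> n < \<sigma> (Suc n)
      then of_nat k + (of_nat k - 1) * (x - 1) else of_nat k)" if "n \<noteq> 0 \<longrightarrow> b < k" for b
  proof (cases "n \<noteq> 0 \<and> \<sigma> n < \<sigma> (Suc n)")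
    case True
    then have "b \<in> {..<k}" using that by simp
    then have "(\<Sum>c<k. ?h c b) = 1 + (\<Sum>c\<in>{..<k} - {b}. ?h c b)"
      by (subst sum.remove) auto
    also have "(\<Sum>c\<in>{..<k} - {b}. ?h c b) = (\<Sum>c\<in>{..<k} - {b}. x)"
      using True by (intro sum.cong) auto
    also have "\<dots> = (of_nat k - 1) * x"
      using \<open>b \<in> {..<k}\<close> assms by simp
    finally show ?thesis using True by (simp add: algebra_simps)
  qed auto
  have "(\<Sum>w\<in>{1..Suc n} \<rightarrow>\<^sub>E {0..<k}. x ^ dmch (Suc n) \<sigma> w)
      = (\<Sum>(c, w)\<in>{0..<k} \<times> ?W. x ^ dmch (Suc n) \<sigma> (w(Suc n := c)))"
  proof -
    have *: "{1..Suc n} = insert (Suc n) {1..n}" by auto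
    have "inj_on (\<lambda>(c, w). w(Suc n := c)) ({0..<k} \<times> ?W)"
      using inj_combinator[of "Suc n" "{1..n}" "\<lambda>_. {0..<k}"] by simp
    then show ?thesis
      unfolding * PiE_insert_eq by (subst sum.reindex) (auto simp: case_prod_unfold)
  qed
  also have "\<dots> = (\<Sum>w\<in>?W. \<Sum>c<k. x ^ dmch n \<sigma> w * ?h c (w n))"
    unfolding sum.cartesian_product[symmetric] dmch
    by (subst sum.swap) (simp add: atLeast0LessThan)
  also have "\<dots> = (\<Sum>w\<in>?W. x ^ dmch n \<sigma> w * (if n \<noteq> 0 \<and> \<sigma> n < \<sigma> (Suc n)
      then of_nat k + (of_nat k - 1) * (x - 1) else of_nat k))"
  proof (intro sum.cong refl)
    fix w assume "w \<in> ?W"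
    then have wn: "n \<noteq> 0 \<longrightarrow> w n < k" by auto
    show "(\<Sum>c<k. x ^ dmch n \<sigma> w * ?h c (w n))
        = x ^ dmch n \<sigma> w * (if n \<noteq> 0 \<and> \<sigma> n < \<sigma> (Suc n)
            then of_nat k + (of_nat k - 1) * (x - 1) else of_nat k)"
      by (simp only: sum_distrib_left[symmetric] inner[OF wn])
  qed
  finally show ?case
    by (simp only: sum_distrib_right[symmetric] Suc.IH) (simp add: asc_prod_def)
qed

lemma sum_wreath:
  fixes p q x :: "'a :: comm_ring_1"
  assumes "k > 0"
  shows "(\<Sum>(\<sigma>, w)\<in>wreath k n. q ^ inv_stat n \<sigma> * p ^ coinv_stat n \<sigma> * x ^ dmch n \<sigma> w)
    = eul_sum p q (of_nat k + (of_nat k - 1) * (x - 1)) (of_nat k) n"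
  unfolding wreath_def sum.cartesian_product[symmetric] eul_sum_def perm_weight_def
  by (simp only: sum_distrib_left[symmetric] sum_dmch_words[OF assms])

section \<open>The field of rational functions\<close>

lemma of_nat_fract: "(of_nat n :: 'a :: idom fract) = to_fract (of_nat n)"
  by (induction n) simp_all

lemma of_nat_ratfun_neq_0: "n > 0 \<Longrightarrow> (of_nat n :: ratfun_pqx) \<noteq> 0"
  by (simp add: of_nat_fract)

lemma x_var_neq_1: "x_var \<noteq> 1"
proof
  assume "x_var = 1"
  then have "to_fract [:0, 1:] = (to_fract 1 :: ratfun_pqx)" by (simp add: x_var_def)
  then show False by (simp add: pCons_one[symmetric] del: to_fract_1)
qed

text \<open>The element comes from a polynomial, and setting all three variables to 1 there yields
  the nonzero number \<open>Suc n\<close>.\<close>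

lemma pq_num_neq_0: "pq_num p_var q_var (Suc n) \<noteq> 0"
proof -
  let ?P = "[:[:[:0, 1:]:]:] :: rat poly poly poly" and ?Q = "[:[:0, 1:]:] :: rat poly poly poly"
  have hom: "to_fract (P ^ i) = to_fract P ^ i" for P :: "rat poly poly poly" and i
    by (induction i) simp_all
  have hom_sum: "to_fract (sum f A) = (\<Sum>i\<in>A. to_fract (f i))"
    for f :: "nat \<Rightarrow> rat poly poly poly" and A
    by (induction A rule: infinite_finite_induct) simp_all
  have "pq_num p_var q_var (Suc n) = to_fract (pq_num ?P ?Q (Suc n))"
    by (simp add: pq_num_def p_var_def q_var_def hom hom_sum)
  moreover have "poly (poly (poly (pq_num ?P ?Q (Suc n)) 1) 1) 1 = of_nat (Suc n)"
    by (simp add: pq_num_def poly_sum)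
  then have "pq_num ?P ?Q (Suc n) \<noteq> 0"
    by (metis of_nat_eq_0_iff poly_0 nat.distinct(1))
  ultimately show ?thesis by simp
qed

lemma pq_fact_neq_0: "pq_fact p_var q_var n \<noteq> 0"
  by (induction n) (simp_all add: pq_fact_Suc pq_num_neq_0)

theorem theorem8:
  fixes k :: nat
  assumes "k \<ge> 2"
  shows
    "Abs_fps (\<lambda>n.
        (\<Sum>(\<sigma>, w) \<in> wreath k n.
            q_var ^ inv_stat n \<sigma> * p_var ^ coinv_stat n \<sigma> * x_var ^ dmch n \<sigma> w)
          / pq_fact p_var q_var n)
     = fps_const ((of_nat k - 1) * (1 - x_var))
       / (fps_const ((of_nat k - 1) * (1 - x_var))
          + fps_const (of_nat k) *
              Abs_fps (\<lambda>n. if n = 0 then 0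
                else p_var ^ (n choose 2) * ((of_nat k - 1) * (x_var - 1)) ^ n
                       / pq_fact p_var q_var n))"
proof -
  let ?b = "of_nat k :: ratfun_pqx"
  let ?a = "?b + (?b - 1) * (x_var - 1)"
  \<comment> \<open>From \<open>k \<ge> 2\<close> and x different from 1 follows
    \<open>?a \<noteq> ?b\<close>, so the denominator series has a nonzero constant
    coefficient.\<close>
  have "?b - 1 = of_nat (k - 1)" using assms by simp
  then have "?b - 1 \<noteq> 0" using assms of_nat_ratfun_neq_0[of "k - 1"] by simp
  then have "?a \<noteq> ?b" using x_var_neq_1 by simp
  then have "Abs_fps (\<lambda>n. eul_sum p_var q_var ?a ?b n / pq_fact p_var q_var n)
      = fps_const (?b - ?a) / (fps_const (?b - ?a) + fps_const ?b *
        Abs_fps (\<lambda>n. if n = 0 then 0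
          else p_var ^ (n choose 2) * (?a - ?b) ^ n / pq_fact p_var q_var n))"
    by (intro fps_eul_sum pq_fact_neq_0)
  moreover have "?b - ?a = (?b - 1) * (1 - x_var)" "?a - ?b = (?b - 1) * (x_var - 1)"
    by (simp_all add: algebra_simps)
  moreover have "k > 0" using assms by simp
  ultimately show ?thesis by (simp only: sum_wreath)
qed

end
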